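(* Let $n\ge1$ and let $P$ be a complex polynomial of degree $n$ having all its zeros in $\{z\in\mathbb{C}:|z|\ge 1\}$; that is, $P(z)=\alpha_n\prod_{j=1}^n(z-b_j)=\alpha_0+\alpha_1z+\dots+\alpha_nz^n$, $\alpha_n\ne0$, $|b_j|\ge1$ for $j=1,\dots,n$. Then for every $z\in\mathbb{C}$ with $|z|=1$, $$|P'(z)|\le\frac12\left[n-\frac{|P(z)|^2}{\{M(P,1)\}^2}\left\{\frac{|\alpha_0|-|\alpha_n|}{|\alpha_0|+|\alpha_n|}\right\}\right]M(P,1).$$
   Context: $M(P,1)=\sup_{|z|=1}|P(z)|$. *)

theory Defs
  imports "HOL-Analysis.Analysis" "HOL-Computational_Algebra.Polynomial"
begin

(* M(P, r).  The SUP is taken in the reals, so it is meaningful only for r \<ge> 0, where the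
   circle is nonempty and compact. *)
definition max_modulus :: "complex poly \<Rightarrow> real \<Rightarrow> real" where
  "max_modulus P r = (SUP z \<in> {z::complex. cmod z = r}. cmod (poly P z))"

end

theory Submission
  imports Defs "HOL-Complex_Analysis.Conformal_Mappings"
    "HOL-Computational_Algebra.Fundamental_Theorem_Algebra"
begin

text \<open>
  Write \<open>A = n P(z) - z P'(z)\<close>, whose modulus on the unit circle is that of the derivative of the
  reciprocal polynomial, and \<open>c = (|\<alpha>\<^sub>0| - |\<alpha>\<^sub>n|) / (|\<alpha>\<^sub>0| + |\<alpha>\<^sub>n|)\<close>.
  Since \<open>Re (z / (z - b)) \<le> 1 / (1 + |b|)\<close> for \<open>|z| = 1 \<le> |b|\<close> and \<open>(r - 1) / (r + 1) = tanh (ln r / 2)\<close>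
  is subadditive in \<open>ln r\<close>, summing over the zeros gives \<open>2 Re (z P'(z) / P(z)) \<le> n - c\<close>,
  that is, \<open>|P'|\<^sup>2 + n c |P|\<^sup>2 \<le> |A|\<^sup>2\<close>.
  Applying \<open>|F'| \<le> |n F - z F'|\<close> to \<open>F = P - \<lambda>\<close> with \<open>|\<lambda>| > M\<close>, which has no zeros in the
  closed disc, and choosing the argument of \<open>\<lambda>\<close>, gives \<open>|P'| + |A| \<le> n M\<close>.
  The two estimates combine to \<open>n c |P|\<^sup>2 \<le> n\<^sup>2 M\<^sup>2 - 2 n M |P'|\<close>.
\<close>

section \<open>Lower bound for \<open>|n P - z P'|\<close> from the location of the zeros\<close>

definition end_coeff_ratio :: "complex poly \<Rightarrow> real" where
  "end_coeff_ratio P =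
     (cmod (coeff P 0) - cmod (lead_coeff P)) / (cmod (coeff P 0) + cmod (lead_coeff P))"

text \<open>This is \<open>Re (z / (z - b)) <= 1 / (1 + |b|)\<close> multiplied by
  \<open>2 |z - b|^2\<close>, so that \<open>z = b\<close> is allowed. The quotient in
  \<open>|b|\<close> is the end coefficient ratio of the factor \<open>z - b\<close>.\<close>

lemma linear_factor_bound:
  assumes "cmod z = 1" "cmod b \<ge> 1"
  shows "2 * Re (z * cnj (z - b)) \<le> (1 - (cmod b - 1) / (cmod b + 1)) * (cmod (z - b))\<^sup>2"
proof -
  define r x where "r = cmod b" and "x = Re (z * cnj b)"
  have r: "r \<ge> 1" using assms by (simp add: r_def)
  have zz: "Re z * Re z + Im z * Im z = 1"
    using assms(1) by (metis cmod_power2 one_power2 power2_eq_square)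
  have rr: "Re b * Re b + Im b * Im b = r\<^sup>2"
    using cmod_power2[of b] by (simp add: r_def power2_eq_square)
  have lhs: "Re (z * cnj (z - b)) = 1 - x"
    using zz by (simp add: x_def algebra_simps)
  have sq: "(cmod (z - b))\<^sup>2 = 1 - 2 * x + r\<^sup>2"
    unfolding cmod_power2 x_def using zz rr by (simp add: power2_eq_square algebra_simps)
  have "\<bar>x\<bar> \<le> r"
    using abs_Re_le_cmod[of "z * cnj b"] assms(1) by (simp add: x_def r_def norm_mult)
  \<comment> \<open>The product is exactly the right side minus the left side of the next
    inequality.\<close>
  hence "(r - 1) * (r + x) \<ge> 0" using r by simp
  hence "(1 - x) * (r + 1) \<le> 1 - 2 * x + r\<^sup>2"
    by (simp add: algebra_simps power2_eq_square)
  hence "1 - x \<le> (1 - 2 * x + r\<^sup>2) / (r + 1)"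
    using r by (simp add: pos_le_divide_eq)
  hence "2 * (1 - x) \<le> 2 * ((1 - 2 * x + r\<^sup>2) / (r + 1))"
    by (rule mult_left_mono) simp
  hence "2 * (1 - x) \<le> 2 / (r + 1) * (1 - 2 * x + r\<^sup>2)" by simp
  moreover have "1 - (r - 1) / (r + 1) = 2 / (r + 1)"
    using r by (simp add: field_simps)
  ultimately show ?thesis unfolding lhs sq r_def[symmetric] by (simp only:)
qed

text \<open>Both sides have numerator \<open>r * a - d >= 0\<close> up to a factor 2, so only
  denominators are compared: \<open>2 (r a + d) - (r + 1) (a + d) = (r - 1) (a - d)\<close>.\<close>

lemma ratio_subadditive:
  fixes a d r :: real
  assumes "r \<ge> 1" "a \<ge> d" "d > 0"
  shows "(r * a - d) / (r * a + d) \<le> (r - 1) / (r + 1) + (a - d) / (a + d)"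
proof -
  have ra: "r * a \<ge> d"
    using assms mult_right_mono[of 1 r a] by linarith
  have pos: "r + 1 > 0" "a + d > 0" "r * a + d > 0" using assms ra by auto
  have eq: "(r - 1) / (r + 1) + (a - d) / (a + d) = 2 * (r * a - d) / ((r + 1) * (a + d))"
    using pos by (simp add: add_frac_eq algebra_simps)
  have "(r - 1) * (a - d) \<ge> 0" using assms by simp
  hence "(r + 1) * (a + d) \<le> 2 * (r * a + d)" by (simp add: algebra_simps)
  hence "(r * a - d) * ((r + 1) * (a + d)) \<le> (r * a - d) * (2 * (r * a + d))"
    by (rule mult_left_mono) (use ra in simp)
  hence "(r * a - d) * ((r + 1) * (a + d)) \<le> 2 * (r * a - d) * (r * a + d)"
    by (simp only: mult_ac)
  thus ?thesis unfolding eq using pos by (subst frac_le_eq) (auto intro!: divide_nonpos_pos)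
qed

text \<open>Induction splitting off one linear factor at a time. The first claim is carried along
  because, for the cofactor, it is the hypothesis \<open>a >= d\<close> of
  \<open>ratio_subadditive\<close>. Multiplying by \<open>|P(z)|^2\<close> avoids dividing by
  \<open>P(z)\<close> when \<open>z\<close> is a zero.\<close>

lemma zeros_outside_disc:
  assumes "P \<noteq> 0" "\<And>b. poly P b = 0 \<Longrightarrow> cmod b \<ge> 1" "cmod z = 1"
  shows "cmod (coeff P 0) \<ge> cmod (lead_coeff P)"
    and "2 * Re (z * poly (pderiv P) z * cnj (poly P z))
           \<le> (real (degree P) - end_coeff_ratio P) * (cmod (poly P z))\<^sup>2"
proof -
  have "cmod (coeff P 0) \<ge> cmod (lead_coeff P) \<and>
     2 * Re (z * poly (pderiv P) z * cnj (poly P z))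
           \<le> (real (degree P) - end_coeff_ratio P) * (cmod (poly P z))\<^sup>2"
    using assms(1,2)
  proof (induction "degree P" arbitrary: P)
    case 0
    then obtain a where "P = [:a:]" by (metis degree_eq_zeroE)
    thus ?case by (simp add: end_coeff_ratio_def pderiv_pCons)
  next
    case (Suc n)
    have "\<not> constant (poly P)"
      using Suc.hyps(2) by (simp add: constant_degree)
    then obtain b where b: "poly P b = 0"
      using fundamental_theorem_of_algebra by blast
    then obtain R where R: "P = [:- b, 1:] * R"
      unfolding poly_eq_0_iff_dvd by (auto elim: dvdE)
    have R0: "R \<noteq> 0" using R Suc.prems by auto
    have deg: "degree P = Suc (degree R)"
      unfolding R using R0 by (subst degree_mult_eq) auto
    have lc: "lead_coeff P = lead_coeff R"
      unfolding R by (simp only: lead_coeff_mult) simp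
    have c0: "coeff P 0 = - b * coeff R 0" unfolding R by (simp add: coeff_mult)
    have r1: "cmod b \<ge> 1" using b Suc.prems by blast
    have "cmod (coeff R 0) \<ge> cmod (lead_coeff R) \<and>
       2 * Re (z * poly (pderiv R) z * cnj (poly R z))
           \<le> (real (degree R) - end_coeff_ratio R) * (cmod (poly R z))\<^sup>2"
    proof (rule Suc.hyps(1))
      show "n = degree R" using Suc.hyps(2) deg by simp
      show "\<And>b. poly R b = 0 \<Longrightarrow> cmod b \<ge> 1" using Suc.prems R by auto
    qed (fact R0)
    hence IH1: "cmod (coeff R 0) \<ge> cmod (lead_coeff R)"
      and IH2: "2 * Re (z * poly (pderiv R) z * cnj (poly R z))
           \<le> (real (degree R) - end_coeff_ratio R) * (cmod (poly R z))\<^sup>2"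
      by auto
    have 1: "cmod (coeff P 0) \<ge> cmod (lead_coeff P)"
      unfolding lc c0 using IH1 mult_right_mono[OF r1, of "cmod (coeff R 0)"]
      by (simp add: norm_mult)
    define u where "u = (cmod b - 1) / (cmod b + 1)"
    have ratio: "end_coeff_ratio P \<le> u + end_coeff_ratio R"
      using ratio_subadditive[OF r1 IH1] R0
      unfolding end_coeff_ratio_def lc c0 u_def by (simp add: norm_mult)
    define w p q where "w = z - b" and "p = poly R z" and "q = poly (pderiv R) z"
    have Pz: "poly P z = w * p" unfolding R w_def p_def by (simp add: algebra_simps)
    have P'z: "poly (pderiv P) z = p + w * q"
      unfolding R w_def p_def q_def pderiv_mult
      by (simp add: pderiv_pCons algebra_simps)
    \<comment> \<open>Additivity of the logarithmic derivative,
      \<open>z P'/P = z/w + z R'/R\<close>, multiplied by \<open>|w|^2 |p|^2\<close>.\<close>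
    have "z * poly (pderiv P) z * cnj (poly P z)
        = z * cnj w * (p * cnj p) + (w * cnj w) * (z * q * cnj p)"
      unfolding Pz P'z by (simp add: algebra_simps)
    also have "\<dots> = z * cnj w * of_real ((cmod p)\<^sup>2) + of_real ((cmod w)\<^sup>2) * (z * q * cnj p)"
      by (simp only: complex_norm_square)
    finally have "2 * Re (z * poly (pderiv P) z * cnj (poly P z))
        = 2 * Re (z * cnj w) * (cmod p)\<^sup>2 + (cmod w)\<^sup>2 * (2 * Re (z * q * cnj p))"
      by (simp add: algebra_simps)
    also have "\<dots> \<le> ((1 - u) * (cmod w)\<^sup>2) * (cmod p)\<^sup>2
        + (cmod w)\<^sup>2 * ((real (degree R) - end_coeff_ratio R) * (cmod p)\<^sup>2)"
      using IH2 linear_factor_bound[OF assms(3) r1]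
      unfolding u_def w_def p_def q_def
      by (intro add_mono mult_right_mono mult_left_mono) simp_all
    also have "\<dots> = (real (degree P) - (u + end_coeff_ratio R)) * (cmod (poly P z))\<^sup>2"
      unfolding deg Pz by (simp add: norm_mult power_mult_distrib algebra_simps)
    also have "\<dots> \<le> (real (degree P) - end_coeff_ratio P) * (cmod (poly P z))\<^sup>2"
      using ratio by (intro mult_right_mono) auto
    finally show ?case using 1 by blast
  qed
  thus "cmod (coeff P 0) \<ge> cmod (lead_coeff P)"
    and "2 * Re (z * poly (pderiv P) z * cnj (poly P z))
           \<le> (real (degree P) - end_coeff_ratio P) * (cmod (poly P z))\<^sup>2" by auto
qed

text \<open>Expanding the square on the right leaves the cross term
  \<open>- 2 n Re (q * cnj p)\<close>, which \<open>zeros_outside_disc\<close> controls; the terms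
  \<open>n^2 |p|^2\<close> cancel.\<close>

lemma reciprocal_deriv_lower_bound:
  assumes "P \<noteq> 0" "\<And>b. poly P b = 0 \<Longrightarrow> cmod b \<ge> 1" "cmod z = 1"
  shows "(cmod (poly (pderiv P) z))\<^sup>2
           + real (degree P) * end_coeff_ratio P * (cmod (poly P z))\<^sup>2
         \<le> (cmod (of_nat (degree P) * poly P z - z * poly (pderiv P) z))\<^sup>2"
proof -
  define n p q where "n = real (degree P)" and "p = poly P z" and "q = z * poly (pderiv P) z"
  have q: "cmod q = cmod (poly (pderiv P) z)"
    using assms(3) by (simp add: q_def norm_mult)
  have "(cmod (of_real n * p - q))\<^sup>2 = n\<^sup>2 * (cmod p)\<^sup>2 - n * (2 * Re (q * cnj p)) + (cmod q)\<^sup>2"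
    unfolding cmod_power2 by (simp add: power2_eq_square algebra_simps)
  moreover have "n * (2 * Re (q * cnj p)) \<le> n * ((n - end_coeff_ratio P) * (cmod p)\<^sup>2)"
    using zeros_outside_disc(2)[OF assms]
    unfolding n_def p_def q_def by (intro mult_left_mono) auto
  moreover have "n * ((n - end_coeff_ratio P) * (cmod p)\<^sup>2)
      = n\<^sup>2 * (cmod p)\<^sup>2 - n * end_coeff_ratio P * (cmod p)\<^sup>2"
    by (simp add: algebra_simps power2_eq_square)
  ultimately have "(cmod q)\<^sup>2 + n * end_coeff_ratio P * (cmod p)\<^sup>2 \<le> (cmod (of_real n * p - q))\<^sup>2"
    by linarith
  thus ?thesis unfolding q by (simp add: n_def p_def q_def)
qed

lemma deriv_le_reciprocal_deriv:
  assumes "P \<noteq> 0" "\<And>b. poly P b = 0 \<Longrightarrow> cmod b \<ge> 1" "cmod z = 1"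
  shows "cmod (poly (pderiv P) z)
         \<le> cmod (of_nat (degree P) * poly P z - z * poly (pderiv P) z)"
proof -
  have "end_coeff_ratio P \<ge> 0"
    using zeros_outside_disc(1)[OF assms] by (simp add: end_coeff_ratio_def)
  hence "real (degree P) * end_coeff_ratio P * (cmod (poly P z))\<^sup>2 \<ge> 0" by simp
  with reciprocal_deriv_lower_bound[OF assms]
  have "(cmod (poly (pderiv P) z))\<^sup>2
      \<le> (cmod (of_nat (degree P) * poly P z - z * poly (pderiv P) z))\<^sup>2" by linarith
  thus ?thesis by (rule power2_le_imp_le) simp
qed

section \<open>Upper bound for \<open>|P'| + |n P - z P'|\<close> from the maximum modulus
  principle\<close>

lemma norm_poly_le_max_modulus:
  assumes "cmod z \<le> 1"
  shows "cmod (poly P z) \<le> max_modulus P 1"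
proof (rule maximum_modulus_frontier[of "poly P" "cball 0 1"])
  fix w :: complex
  assume "w \<in> frontier (cball 0 1)"
  hence w: "w \<in> {z. cmod z = 1}" by simp
  \<comment> \<open>A real \<open>SUP\<close> dominates its members only when they are bounded
    above; compactness of the circle supplies this.\<close>
  have "compact {z. cmod z = 1}"
    using compact_sphere[of "0 :: complex" 1] by (simp add: sphere_def)
  hence "compact ((\<lambda>z. cmod (poly P z)) ` {z. cmod z = 1})"
    by (intro compact_continuous_image continuous_intros)
  hence "bdd_above ((\<lambda>z. cmod (poly P z)) ` {z. cmod z = 1})"
    by (intro bounded_imp_bdd_above compact_imp_bounded)
  thus "cmod (poly P w) \<le> max_modulus P 1"
    unfolding max_modulus_def using w by (intro cSUP_upper)
qed (use assms in \<open>auto intro!: holomorphic_intros continuous_intros\<close>)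

lemma deriv_plus_reciprocal_deriv_le:
  assumes n: "degree P \<ge> 1" and z: "cmod z = 1"
  shows "cmod (poly (pderiv P) z)
           + cmod (of_nat (degree P) * poly P z - z * poly (pderiv P) z)
         \<le> real (degree P) * max_modulus P 1"
proof -
  define n M A where "n = real (degree P)" and "M = max_modulus P 1"
    and "A = of_nat (degree P) * poly P z - z * poly (pderiv P) z"
  have npos: "n > 0" using n by (simp add: n_def)
  have M0: "M \<ge> 0"
    using norm_poly_le_max_modulus[of z P] z norm_ge_zero[of "poly P z"]
    unfolding M_def by linarith
  \<comment> \<open>The absolute value stays until the sign of \<open>cmod A - n * K\<close> is
    settled by \<open>AM\<close>.\<close>
  have key: "cmod (poly (pderiv P) z) \<le> \<bar>cmod A - n * K\<bar>" if K: "K > M" for K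
  proof -
    \<comment> \<open>The constant subtracted from \<open>P\<close> points in the direction of
      \<open>A\<close>, so that \<open>A\<close> and \<open>n K u\<close> subtract as real multiples
      of \<open>u\<close>. The value 1 keeps \<open>u\<close> unimodular when \<open>sgn A\<close>
      would be 0.\<close>
    define u where "u = (if A = 0 then 1 else sgn A)"
    have u: "cmod u = 1" "A = of_real (cmod A) * u"
      by (simp_all add: u_def norm_sgn) (simp add: sgn_eq)
    define F where "F = P - [:of_real K * u:]"
    have deg: "degree F = degree P"
      using n unfolding F_def diff_conv_add_uminus by (intro degree_add_eq_left) simp
    have F0: "F \<noteq> 0" using deg n by auto
    have roots: "cmod b \<ge> 1" if "poly F b = 0" for b
    proof (rule ccontr)
      assume "\<not> cmod b \<ge> 1"
      hence "cmod (poly P b) \<le> M"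
        unfolding M_def by (intro norm_poly_le_max_modulus) simp
      moreover have "poly P b = of_real K * u" using that by (simp add: F_def)
      hence "cmod (poly P b) = \<bar>K\<bar>" using u by (simp add: norm_mult)
      ultimately show False using K by simp
    qed
    have dF: "pderiv F = pderiv P" by (simp add: F_def pderiv_diff pderiv_pCons)
    have "of_nat (degree F) * poly F z - z * poly (pderiv F) z = A - of_real (n * K) * u"
      unfolding deg dF A_def n_def by (simp add: F_def algebra_simps)
    also have "\<dots> = of_real (cmod A - n * K) * u"
      using u(2) by (simp add: algebra_simps)
    finally show ?thesis
      using deriv_le_reciprocal_deriv[OF F0 roots z] u(1)
      by (simp only: dF norm_mult norm_of_real) simp
  qed
  \<comment> \<open>Otherwise \<open>K = cmod A / n\<close> is admissible in \<open>key\<close> and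
    forces \<open>P'(z) = 0\<close>; then \<open>cmod A = n |P(z)|\<close>, which is at most
    \<open>n M\<close>.\<close>
  have AM: "cmod A \<le> n * M"
  proof (rule ccontr)
    assume neg: "\<not> cmod A \<le> n * M"
    hence "cmod A / n > M" using npos by (simp add: field_simps)
    from key[OF this] have "poly (pderiv P) z = 0" using npos by simp
    hence "cmod A = n * cmod (poly P z)" by (simp add: A_def n_def norm_mult)
    also have "\<dots> \<le> n * M"
      using npos z norm_poly_le_max_modulus[of z P] unfolding M_def
      by (intro mult_left_mono) auto
    finally show False using neg by simp
  qed
  have "(cmod (poly (pderiv P) z) + cmod A) / n \<le> M"
  \<comment> \<open>\<open>key\<close> needs \<open>K\<close> strictly above \<open>M\<close>, so
    the bound at \<open>M\<close> is reached as a limit.\<close>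
  proof (rule dense_ge)
    fix K assume K: "M < K"
    hence "n * M \<le> n * K" using npos by simp
    hence "cmod (poly (pderiv P) z) \<le> n * K - cmod A" using key[OF K] AM by simp
    thus "(cmod (poly (pderiv P) z) + cmod A) / n \<le> K"
      using npos by (simp add: field_simps)
  qed
  thus ?thesis using npos unfolding n_def M_def A_def by (simp add: field_simps)
qed

theorem corollary5:
  fixes P :: "complex poly" and n :: nat and z :: complex
  assumes "n \<ge> 1"
    and "degree P = n"
    and "\<And>b. poly P b = 0 \<Longrightarrow> cmod b \<ge> 1"
    and "cmod z = 1"
  shows "cmod (poly (pderiv P) z)
    \<le> 1 / 2 * (real n - (cmod (poly P z))\<^sup>2 / (max_modulus P 1)\<^sup>2
          * ((cmod (coeff P 0) - cmod (coeff P n)) / (cmod (coeff P 0) + cmod (coeff P n))))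
        * max_modulus P 1"
proof -
  define M p q A c where "M = max_modulus P 1" and "p = cmod (poly P z)"
    and "q = cmod (poly (pderiv P) z)"
    and "A = cmod (of_nat n * poly P z - z * poly (pderiv P) z)" and "c = end_coeff_ratio P"
  have P0: "P \<noteq> 0" using assms(1,2) by auto
  have lower: "q\<^sup>2 + real n * c * p\<^sup>2 \<le> A\<^sup>2"
    using reciprocal_deriv_lower_bound[OF P0 assms(3,4)] assms(2)
    by (simp add: q_def p_def A_def c_def)
  have upper: "q + A \<le> real n * M"
    using deriv_plus_reciprocal_deriv_le[of P z] assms
    by (simp add: q_def A_def M_def)
  have nonneg: "q \<ge> 0" "A \<ge> 0" by (simp_all add: q_def A_def)
  have "p \<le> M"
    using norm_poly_le_max_modulus[of z P] assms(4) by (simp add: p_def M_def)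
  hence M0: "M \<ge> 0" using norm_ge_zero[of "poly P z"] unfolding p_def by linarith
  have "q \<le> 1 / 2 * (real n - p\<^sup>2 / M\<^sup>2 * c) * M"
  proof (cases "M = 0")
    case True
    thus ?thesis using upper nonneg by simp
  next
    case False
    \<comment> \<open>Compared with \<open>lower\<close>, the squares of \<open>q\<close> cancel and
      a common factor \<open>n\<close> remains to be divided out.\<close>
    have "A\<^sup>2 \<le> (real n * M - q)\<^sup>2"
      using upper nonneg by (intro power_mono) auto
    with lower have "real n * (c * p\<^sup>2) \<le> real n * (real n * M\<^sup>2 - 2 * M * q)"
      by (simp add: power2_eq_square algebra_simps)
    hence "c * p\<^sup>2 \<le> real n * M\<^sup>2 - 2 * M * q"
      using assms(1) by (simp add: mult_le_cancel_left)
    moreover have "(real n - p\<^sup>2 / M\<^sup>2 * c) * M * M = real n * M\<^sup>2 - c * p\<^sup>2"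
      using False by (simp add: algebra_simps power2_eq_square)
    ultimately have "2 * q * M \<le> (real n - p\<^sup>2 / M\<^sup>2 * c) * M * M"
      by (simp add: algebra_simps)
    hence "2 * q \<le> (real n - p\<^sup>2 / M\<^sup>2 * c) * M"
      by (rule mult_right_le_imp_le) (use False M0 in simp)
    thus ?thesis by simp
  qed
  thus ?thesis
    unfolding q_def p_def M_def c_def end_coeff_ratio_def assms(2) by simp
qed

end
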